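(* $Avg$ is strong monotone for $s$-sets with $s>0$. That is, $Avg$ restricted to those bounded sets $H\subset\mathbb{R}$ that are $s$-sets for some $0<s\le 1$ (where $s$ may depend on the set) is strong monotone.
   Context: $\mu^s$ denotes the $s$-dimensional Hausdorff measure on $\mathbb{R}$ ($0\le s\le 1$). $H\subset\mathbb{R}$ is an $s$-set if it is $\mu^s$-measurable and $0<\mu^s(H)<+\infty$. For a bounded $s$-set $H$, $Avg(H)=\frac{\int_H x\,d\mu^s}{\mu^s(H)}$ (for a given $H$ there is at most one such $s$). For infinite bounded $H$, $\varliminf H=\inf H'$, $\varlimsup H=\sup H'$, where $H'$ is the set of accumulation points of $H$. A function $\mathcal{K}$ defined on some bounded subsets of $\mathbb{R}$ is strong internal if $\varliminf H\le\mathcal{K}(H)\le\varlimsup H$ for all infinite $H\in Dom(\mathcal{K})$. It is strong monotone if it is strong internal and $\varlimsup H_1\le\varliminf H_2$ implies $\mathcal{K}(H_1)\le\mathcal{K}(H_1\cup H_2)\le\mathcal{K}(H_2)$. *)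

theory Defs
  imports "HOL-Analysis.Analysis"
begin

section \<open>Hausdorff measure on the real line\<close>

text \<open>
  \<open>hausdorff_gauge s U\<close> is $|U|^s$ with the usual conventions $|\emptyset|^s = 0$ (so that
  finite covers are allowed) and $0^0 = 1$ (so that \<open>s = 0\<close> gives counting measure);
  \<open>powr\<close> alone would yield \<open>0 powr 0 = 0\<close>.
\<close>
definition hausdorff_gauge :: "real \<Rightarrow> real set \<Rightarrow> ennreal" where
  "hausdorff_gauge s U =
     (if U = {} then 0 else if s = 0 then 1 else ennreal (diameter U powr s))"

text \<open>Boundedness is required explicitly because \<open>diameter\<close> is unspecified on unbounded sets.\<close>
definition hausdorff_covers :: "real \<Rightarrow> real set \<Rightarrow> (nat \<Rightarrow> real set) set" where
  "hausdorff_covers \<delta> A =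
     {U. A \<subseteq> (\<Union>i. U i) \<and> (\<forall>i. bounded (U i) \<and> diameter (U i) \<le> \<delta>)}"

definition hausdorff_premeasure :: "real \<Rightarrow> real \<Rightarrow> real set \<Rightarrow> ennreal" where
  "hausdorff_premeasure s \<delta> A = (INF U\<in>hausdorff_covers \<delta> A. \<Sum>i. hausdorff_gauge s (U i))"

definition hausdorff_outer :: "real \<Rightarrow> real set \<Rightarrow> ennreal" where
  "hausdorff_outer s A = (SUP \<delta>\<in>{0<..}. hausdorff_premeasure s \<delta> A)"

text \<open>
  The measure $\mu^s$: its measurable sets are the Caratheodory-measurable sets of the outer
  measure. No normalising constant is used; it would cancel in the average below.
\<close>
definition hausdorff_measure :: "real \<Rightarrow> real measure" where
  "hausdorff_measure s =
     measure_of UNIV (lambda_system UNIV (Pow UNIV) (hausdorff_outer s)) (hausdorff_outer s)"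


subsection \<open>The measure is well defined\<close>

lemma hausdorff_gauge_empty [simp]: "hausdorff_gauge s {} = 0"
  by (simp add: hausdorff_gauge_def)

lemma hausdorff_premeasure_empty:
  assumes "0 < \<delta>"
  shows "hausdorff_premeasure s \<delta> {} = 0"
proof -
  have "(\<lambda>_. {}) \<in> hausdorff_covers \<delta> {}"
    using assms by (simp add: hausdorff_covers_def)
  then have "hausdorff_premeasure s \<delta> {} \<le> (\<Sum>i::nat. hausdorff_gauge s {})"
    unfolding hausdorff_premeasure_def by (rule INF_lower2) simp
  then show ?thesis by simp
qed

lemma hausdorff_premeasure_mono:
  assumes "A \<subseteq> B"
  shows "hausdorff_premeasure s \<delta> A \<le> hausdorff_premeasure s \<delta> B"
  unfolding hausdorff_premeasure_def
  by (rule INF_superset_mono) (use assms in \<open>auto simp: hausdorff_covers_def\<close>)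

lemma hausdorff_premeasure_countably_subadditive:
  "hausdorff_premeasure s \<delta> (\<Union>i. A i) \<le> (\<Sum>i. hausdorff_premeasure s \<delta> (A i))"
proof (rule ennreal_le_epsilon)
  fix e :: real
  assume fin: "(\<Sum>i. hausdorff_premeasure s \<delta> (A i)) < top" and e: "0 < e"
  have "\<exists>U. U \<in> hausdorff_covers \<delta> (A n) \<and>
          (\<Sum>i. hausdorff_gauge s (U i))
            \<le> hausdorff_premeasure s \<delta> (A n) + ennreal (e * (1/2) ^ Suc n)" for n
  proof -
    have "hausdorff_premeasure s \<delta> (A n) < top"
      using fin ennreal_suminf_lessD by blast
    then have "hausdorff_premeasure s \<delta> (A n)
        < hausdorff_premeasure s \<delta> (A n) + ennreal (e * (1/2) ^ Suc n)"
      using e by (simp add: ennreal_add_left_cancel_less[where b = 0, simplified])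
    then show ?thesis
      unfolding hausdorff_premeasure_def INF_less_iff by (auto intro: less_imp_le)
  qed
  then obtain U where U: "\<And>n. U n \<in> hausdorff_covers \<delta> (A n)"
    and le: "\<And>n. (\<Sum>i. hausdorff_gauge s (U n i))
              \<le> hausdorff_premeasure s \<delta> (A n) + ennreal (e * (1/2) ^ Suc n)"
    by metis
  define V where "V k = case_prod U (prod_decode k)" for k
  have "\<And>x n. x \<in> A n \<Longrightarrow> \<exists>k. x \<in> V k"
  proof -
    fix x n assume "x \<in> A n"
    then obtain i where "x \<in> U n i"
      using U[of n] by (auto simp: hausdorff_covers_def)
    then have "x \<in> V (prod_encode (n, i))" by (simp add: V_def)
    then show "\<exists>k. x \<in> V k" ..
  qed
  then have "V \<in> hausdorff_covers \<delta> (\<Union>i. A i)"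
    using U by (auto simp: hausdorff_covers_def V_def split: prod.split)
  then have "hausdorff_premeasure s \<delta> (\<Union>i. A i) \<le> (\<Sum>k. hausdorff_gauge s (V k))"
    unfolding hausdorff_premeasure_def by (rule INF_lower)
  also have "\<dots> = (\<Sum>k. (\<lambda>(n, i). hausdorff_gauge s (U n i)) (prod_decode k))"
    by (simp add: V_def case_prod_beta)
  also have "\<dots> = (\<Sum>n. \<Sum>i. hausdorff_gauge s (U n i))"
    using suminf_ennreal_2dimen[where f = "\<lambda>(n, i). hausdorff_gauge s (U n i)"
        and g = "\<lambda>n. \<Sum>i. hausdorff_gauge s (U n i)"]
    by (simp add: comp_def)
  also have "\<dots> \<le> (\<Sum>n. hausdorff_premeasure s \<delta> (A n) + ennreal (e * (1/2) ^ Suc n))"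
    by (intro suminf_le le summableI)
  also have "\<dots> = (\<Sum>n. hausdorff_premeasure s \<delta> (A n)) + (\<Sum>n. ennreal (e * (1/2) ^ Suc n))"
    by (rule suminf_add[symmetric]) (auto intro: summableI)
  also have "(\<Sum>n. ennreal (e * (1/2) ^ Suc n)) = ennreal e"
    using sums_mult[OF power_half_series, of e] e
    by (intro suminf_ennreal_eq) auto
  finally show "hausdorff_premeasure s \<delta> (\<Union>i. A i)
      \<le> (\<Sum>n. hausdorff_premeasure s \<delta> (A n)) + ennreal e" .
qed

lemma outer_measure_space_hausdorff_outer:
  "outer_measure_space (Pow UNIV) (hausdorff_outer s)"
  unfolding outer_measure_space_def
proof (intro conjI)
  show "positive (Pow UNIV) (hausdorff_outer s)"
  proof -
    have "hausdorff_outer s {} \<le> 0"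
      unfolding hausdorff_outer_def by (rule SUP_least) (simp add: hausdorff_premeasure_empty)
    then show ?thesis by (simp add: positive_def)
  qed
  show "increasing (Pow UNIV) (hausdorff_outer s)"
    unfolding increasing_def hausdorff_outer_def
    by (auto intro!: SUP_mono hausdorff_premeasure_mono)
  show "countably_subadditive (Pow UNIV) (hausdorff_outer s)"
    unfolding countably_subadditive_def
  proof safe
    fix A :: "nat \<Rightarrow> real set"
    show "hausdorff_outer s (\<Union>i. A i) \<le> (\<Sum>i. hausdorff_outer s (A i))"
      unfolding hausdorff_outer_def
    proof (rule SUP_least)
      fix \<delta> :: real assume "\<delta> \<in> {0<..}"
      then show "hausdorff_premeasure s \<delta> (\<Union>i. A i)
          \<le> (\<Sum>i. SUP \<delta>\<in>{0<..}. hausdorff_premeasure s \<delta> (A i))"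
        by (intro order_trans[OF hausdorff_premeasure_countably_subadditive]
              suminf_le SUP_upper summableI)
    qed
  qed
qed

lemma measure_space_hausdorff:
  "measure_space UNIV (lambda_system UNIV (Pow UNIV) (hausdorff_outer s)) (hausdorff_outer s)"
  by (rule sigma_algebra.caratheodory_lemma[OF sigma_algebra_Pow
        outer_measure_space_hausdorff_outer])

lemma space_hausdorff_measure [simp]: "space (hausdorff_measure s) = UNIV"
  unfolding hausdorff_measure_def by (rule space_measure_of) (auto dest: lambda_system_sets)

lemma sets_hausdorff_measure:
  "sets (hausdorff_measure s) = lambda_system UNIV (Pow UNIV) (hausdorff_outer s)"
  using measure_space_hausdorff[of s] unfolding hausdorff_measure_def
  by (intro sigma_algebra.sets_measure_of_eq) (auto simp: measure_space_def)

lemma emeasure_hausdorff_measure: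
  assumes "A \<in> sets (hausdorff_measure s)"
  shows "emeasure (hausdorff_measure s) A = hausdorff_outer s A"
proof -
  have "sigma_algebra UNIV (lambda_system UNIV (Pow UNIV) (hausdorff_outer s))"
    "positive (lambda_system UNIV (Pow UNIV) (hausdorff_outer s)) (hausdorff_outer s)"
    "countably_additive (lambda_system UNIV (Pow UNIV) (hausdorff_outer s)) (hausdorff_outer s)"
    using measure_space_hausdorff[of s] by (auto simp: measure_space_def)
  then show ?thesis
    using assms unfolding sets_hausdorff_measure
    by (simp add: hausdorff_measure_def emeasure_measure_of_sigma)
qed


section \<open>\<open>s\<close>-sets and their average\<close>

definition s_set :: "real \<Rightarrow> real set \<Rightarrow> bool" where
  "s_set s H \<longleftrightarrow> 0 \<le> s \<and> s \<le> 1 \<and> H \<in> sets (hausdorff_measure s) \<and>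
     0 < emeasure (hausdorff_measure s) H \<and> emeasure (hausdorff_measure s) H < \<infinity>"

text \<open>
  A set is an \<open>s\<close>-set for at most one \<open>s\<close>, so on \<open>s\<close>-sets \<open>THE\<close> selects that value.
  Elsewhere \<open>Avg\<close> carries no meaning.
\<close>
definition Avg :: "real set \<Rightarrow> real" where
  "Avg H =
     (let s = (THE s. s_set s H); M = hausdorff_measure s
      in (LINT x:H|M. x) / measure M H)"


section \<open>Strong internal and strong monotone set functions\<close>

definition lower_lim :: "real set \<Rightarrow> real" where
  "lower_lim H = Inf {x. x islimpt H}"

definition upper_lim :: "real set \<Rightarrow> real" where
  "upper_lim H = Sup {x. x islimpt H}"

text \<open>
  A partial function on bounded sets is modelled by a domain \<open>D\<close> and a total \<open>K\<close> whose values
  outside \<open>D\<close> are ignored.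
\<close>
definition strong_internal_on :: "real set set \<Rightarrow> (real set \<Rightarrow> real) \<Rightarrow> bool" where
  "strong_internal_on D K \<longleftrightarrow> (\<forall>H\<in>D. bounded H) \<and>
     (\<forall>H\<in>D. infinite H \<longrightarrow> lower_lim H \<le> K H \<and> K H \<le> upper_lim H)"

text \<open>
  The inequalities mention \<open>K (H\<^sub>1 \<union> H\<^sub>2)\<close>, so they include the claim that this value is defined,
  that is, that \<open>H\<^sub>1 \<union> H\<^sub>2 \<in> D\<close>. Infinite sets are those for which the two limits make sense.
\<close>
definition strong_monotone_on :: "real set set \<Rightarrow> (real set \<Rightarrow> real) \<Rightarrow> bool" where
  "strong_monotone_on D K \<longleftrightarrow> strong_internal_on D K \<and>
     (\<forall>H\<^sub>1\<in>D. \<forall>H\<^sub>2\<in>D. infinite H\<^sub>1 \<longrightarrow> infinite H\<^sub>2 \<longrightarrow> upper_lim H\<^sub>1 \<le> lower_lim H\<^sub>2 \<longrightarrow>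
        H\<^sub>1 \<union> H\<^sub>2 \<in> D \<and> K H\<^sub>1 \<le> K (H\<^sub>1 \<union> H\<^sub>2) \<and> K (H\<^sub>1 \<union> H\<^sub>2) \<le> K H\<^sub>2)"

end

theory Submission
  imports Defs
begin

text \<open>
  For \<open>s > 0\<close> countable sets are null, and all but countably many points of \<open>H\<close> are accumulation
  points of \<open>H\<close>; so almost all of \<open>H\<close> lies between its lower and upper limit, and hence so does
  the average. For the union of an \<open>s\<close>-set and a \<open>t\<close>-set, if \<open>s = t\<close> the two sets are almost
  disjoint and the average is a weighted mean of the two averages; if \<open>s \<noteq> t\<close> the set of smaller
  dimension is null for the other measure and the average is that of the other set.
\<close>

section \<open>Premeasures: covers, dependence on \<delta>, cutting at a point\<close>

text \<open>\<open>case_nat V U\<close> is a countable cover with \<open>V\<close> put in front. The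
  extra slot later holds an interval that catches the points lost when straddling members are
  removed from a cover.\<close>

lemma hausdorff_premeasure_le_case_nat:
  assumes "bounded V" "diameter V \<le> \<delta>"
    and "\<And>i. bounded (U i) \<and> diameter (U i) \<le> \<delta>"
    and "A \<subseteq> V \<union> (\<Union>i. U i)"
  shows "hausdorff_premeasure s \<delta> A \<le> hausdorff_gauge s V + (\<Sum>i. hausdorff_gauge s (U i))"
proof -
  let ?W = "case_nat V U"
  have "A \<subseteq> (\<Union>i. ?W i)"
  proof
    fix x assume "x \<in> A"
    with assms(4) consider "x \<in> V" | i where "x \<in> U i" by auto
    then show "x \<in> (\<Union>i. ?W i)"
    proof cases
      case 1
      then have "x \<in> ?W 0" by simp
      then show ?thesis by blast
    next
      case 2
      then have "x \<in> ?W (Suc i)" by simp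
      then show ?thesis by blast
    qed
  qed
  then have "?W \<in> hausdorff_covers \<delta> A"
    using assms(1-3) by (simp add: hausdorff_covers_def split: nat.split)
  then have "hausdorff_premeasure s \<delta> A \<le> (\<Sum>i. hausdorff_gauge s (?W i))"
    unfolding hausdorff_premeasure_def by (rule INF_lower)
  also have "\<dots> = hausdorff_gauge s V + (\<Sum>i. hausdorff_gauge s (U i))"
    by (subst suminf_offset[where i = 1]) (auto intro: summableI)
  finally show ?thesis .
qed

lemma hausdorff_premeasure_antimono:
  "\<delta> \<le> \<epsilon> \<Longrightarrow> hausdorff_premeasure s \<epsilon> A \<le> hausdorff_premeasure s \<delta> A"
  unfolding hausdorff_premeasure_def
  by (rule INF_superset_mono) (auto simp: hausdorff_covers_def intro: order_trans)

lemma hausdorff_premeasure_le_outer: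
  "0 < \<delta> \<Longrightarrow> hausdorff_premeasure s \<delta> A \<le> hausdorff_outer s A"
  unfolding hausdorff_outer_def by (rule SUP_upper) simp

text \<open>Shrinking \<delta> only removes covers, so the supremum over all \<delta> is the limit
  along this one sequence. Inequalities between premeasures can therefore be passed to the
  limit.\<close>

lemma tendsto_hausdorff_outer:
  "(\<lambda>n. hausdorff_premeasure s (1 / real (Suc n)) A) \<longlonglongrightarrow> hausdorff_outer s A"
proof -
  have "hausdorff_outer s A = (SUP n. hausdorff_premeasure s (1 / real (Suc n)) A)"
    unfolding hausdorff_outer_def
  proof (rule antisym)
    show "(SUP \<delta>\<in>{0<..}. hausdorff_premeasure s \<delta> A)
        \<le> (SUP n. hausdorff_premeasure s (1 / real (Suc n)) A)"
    proof (rule SUP_mono)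
      fix \<delta> :: real assume "\<delta> \<in> {0<..}"
      then obtain n where "1 / real (Suc n) < \<delta>"
        using reals_Archimedean[of \<delta>] by (auto simp: inverse_eq_divide)
      then show "\<exists>n\<in>UNIV. hausdorff_premeasure s \<delta> A
          \<le> hausdorff_premeasure s (1 / real (Suc n)) A"
        by (auto intro: hausdorff_premeasure_antimono less_imp_le)
    qed
    show "(SUP n. hausdorff_premeasure s (1 / real (Suc n)) A)
        \<le> (SUP \<delta>\<in>{0<..}. hausdorff_premeasure s \<delta> A)"
      by (rule SUP_mono) (auto intro!: bexI[of _ "1 / real (Suc _)"])
  qed
  moreover have "incseq (\<lambda>n. hausdorff_premeasure s (1 / real (Suc n)) A)"
    by (intro monoI hausdorff_premeasure_antimono) (simp add: field_simps)
  ultimately show ?thesis by (simp add: LIMSEQ_SUP)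
qed

text \<open>
  In dimension one no metric outer measure argument is needed: the members of a \<open>\<delta>\<close>-cover that
  straddle \<open>a\<close> all lie in the two intervals of length \<open>\<delta>\<close> adjacent to \<open>a\<close>, whose total gauge
  \<open>2 \<delta>\<^sup>s\<close> vanishes in the limit.
\<close>
lemma hausdorff_premeasure_split_le:
  assumes "0 < s" "0 < \<delta>"
  shows "hausdorff_premeasure s \<delta> (E \<inter> {..a}) + hausdorff_premeasure s \<delta> (E - {..a})
    \<le> 2 * ennreal (\<delta> powr s) + hausdorff_premeasure s \<delta> E"
proof -
  let ?c = "ennreal (\<delta> powr s)"
  have diam: "diameter {x..x + \<delta>} = \<delta>" for x :: real
    using assms by (simp add: diameter_closed_interval)
  have gauge: "hausdorff_gauge s {x..x + \<delta>} = ?c" for x :: real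
    using assms by (simp add: hausdorff_gauge_def diam)
  \<comment> \<open>With the finite error term subtracted, the right-hand side is a bare infimum
    over covers, so a single cover can be fixed.\<close>
  have "hausdorff_premeasure s \<delta> (E \<inter> {..a}) + hausdorff_premeasure s \<delta> (E - {..a}) - 2 * ?c
     \<le> hausdorff_premeasure s \<delta> E"
    unfolding hausdorff_premeasure_def[of s \<delta> E]
  proof (rule INF_greatest)
    fix U assume "U \<in> hausdorff_covers \<delta> E"
    then have cover: "E \<subseteq> (\<Union>i. U i)"
      and U: "\<And>i. bounded (U i)" "\<And>i. diameter (U i) \<le> \<delta>"
      by (auto simp: hausdorff_covers_def)
    \<comment> \<open>Only members on one side of \<open>a\<close> are kept; a straddling member is
      dropped from both families, so each \<open>U i\<close> is charged at most once. The empty set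
      lies on both sides, but its gauge is 0.\<close>
    define L where "L i = (if U i \<subseteq> {..a} then U i else {})" for i
    define R where "R i = (if U i \<subseteq> {a<..} then U i else {})" for i
    have close: "\<bar>x - y\<bar> \<le> \<delta>" if "x \<in> U i" "y \<in> U i" for x y i
      using diameter_bounded_bound[OF U(1) that] U(2)[of i] by (simp add: dist_real_def)
    \<comment> \<open>The upper end \<open>a\<close> is written as
      \<open>a - \<delta> + \<delta>\<close> so that \<open>diam\<close> and \<open>gauge\<close>
      match; this is also why \<open>diff_add_cancel\<close> is switched off below.\<close>
    have "hausdorff_premeasure s \<delta> (E \<inter> {..a})
        \<le> hausdorff_gauge s {a - \<delta>..a - \<delta> + \<delta>} + (\<Sum>i. hausdorff_gauge s (L i))"
    proof (rule hausdorff_premeasure_le_case_nat)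
      show "E \<inter> {..a} \<subseteq> {a - \<delta>..a - \<delta> + \<delta>} \<union> (\<Union>i. L i)"
      proof
        fix x assume x: "x \<in> E \<inter> {..a}"
        then obtain i where i: "x \<in> U i" using cover by auto
        show "x \<in> {a - \<delta>..a - \<delta> + \<delta>} \<union> (\<Union>i. L i)"
        proof (cases "U i \<subseteq> {..a}")
          case True
          then have "x \<in> L i" using i by (simp add: L_def)
          then show ?thesis by blast
        next
          case False
          then obtain y where "y \<in> U i" "a < y" by force
          then show ?thesis using x close[OF i, of y] by auto
        qed
      qed
    qed (use U assms in \<open>auto simp: L_def diam simp del: diff_add_cancel\<close>)
    moreover have "hausdorff_premeasure s \<delta> (E - {..a})
        \<le> hausdorff_gauge s {a..a + \<delta>} + (\<Sum>i. hausdorff_gauge s (R i))"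
    proof (rule hausdorff_premeasure_le_case_nat)
      show "E - {..a} \<subseteq> {a..a + \<delta>} \<union> (\<Union>i. R i)"
      proof
        fix x assume x: "x \<in> E - {..a}"
        then obtain i where i: "x \<in> U i" using cover by auto
        show "x \<in> {a..a + \<delta>} \<union> (\<Union>i. R i)"
        proof (cases "U i \<subseteq> {a<..}")
          case True
          then have "x \<in> R i" using i by (simp add: R_def)
          then show ?thesis by blast
        next
          case False
          then obtain y where "y \<in> U i" "y \<le> a" by force
          then show ?thesis using x close[OF i, of y] by auto
        qed
      qed
    qed (use U assms in \<open>auto simp: R_def diam\<close>)
    ultimately have "hausdorff_premeasure s \<delta> (E \<inter> {..a}) + hausdorff_premeasure s \<delta> (E - {..a})
        \<le> (?c + (\<Sum>i. hausdorff_gauge s (L i))) + (?c + (\<Sum>i. hausdorff_gauge s (R i)))"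
      unfolding gauge by (rule add_mono)
    also have "\<dots> = 2 * ?c + ((\<Sum>i. hausdorff_gauge s (L i)) + (\<Sum>i. hausdorff_gauge s (R i)))"
      by (simp only: mult_2 ac_simps)
    also have "(\<Sum>i. hausdorff_gauge s (L i)) + (\<Sum>i. hausdorff_gauge s (R i))
        = (\<Sum>i. hausdorff_gauge s (L i) + hausdorff_gauge s (R i))"
      by (intro suminf_add summableI)
    also have "\<dots> \<le> (\<Sum>i. hausdorff_gauge s (U i))"
    proof (intro suminf_le summableI)
      fix i
      show "hausdorff_gauge s (L i) + hausdorff_gauge s (R i) \<le> hausdorff_gauge s (U i)"
      proof (cases "U i = {}")
        case False
        then have "\<not> (U i \<subseteq> {..a} \<and> U i \<subseteq> {a<..})" by fastforce
        then show ?thesis by (auto simp: L_def R_def)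
      qed (simp add: L_def R_def)
    qed
    finally have "hausdorff_premeasure s \<delta> (E \<inter> {..a}) + hausdorff_premeasure s \<delta> (E - {..a})
        \<le> 2 * ?c + (\<Sum>i. hausdorff_gauge s (U i))"
      by (simp add: add_left_mono)
    then show "hausdorff_premeasure s \<delta> (E \<inter> {..a}) + hausdorff_premeasure s \<delta> (E - {..a}) - 2 * ?c
        \<le> (\<Sum>i. hausdorff_gauge s (U i))"
      by (simp add: ennreal_minus_le_iff ennreal_mult_eq_top_iff)
  qed
  then show ?thesis by (simp add: ennreal_minus_le_iff ennreal_mult_eq_top_iff)
qed

section \<open>Caratheodory measurability of half-lines\<close>

lemma sets_hausdorff_measure_iff:
  "A \<in> sets (hausdorff_measure s) \<longleftrightarrow>
    (\<forall>E. hausdorff_outer s (E \<inter> A) + hausdorff_outer s (E - A) = hausdorff_outer s E)"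
  using algebra.lambda_system_eq[OF algebra_Pow, of UNIV "hausdorff_outer s"]
  by (simp add: sets_hausdorff_measure)

lemma hausdorff_outer_mono: "A \<subseteq> B \<Longrightarrow> hausdorff_outer s A \<le> hausdorff_outer s B"
  unfolding hausdorff_outer_def by (auto intro!: SUP_mono hausdorff_premeasure_mono)

text \<open>This half of the Caratheodory equation is mere subadditivity, so measurability proofs
  are left with the opposite inequality.\<close>

lemma hausdorff_outer_le_split:
  "hausdorff_outer s E \<le> hausdorff_outer s (E \<inter> A) + hausdorff_outer s (E - A)"
proof -
  have "subadditive (Pow UNIV) (hausdorff_outer s)"
    using outer_measure_space_hausdorff_outer[of s]
    by (intro ring_of_sets.countably_subadditive_subadditive[OF algebra.axioms(1)[OF algebra_Pow]])
       (simp_all add: outer_measure_space_def)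
  then have "hausdorff_outer s ((E \<inter> A) \<union> (E - A))
      \<le> hausdorff_outer s (E \<inter> A) + hausdorff_outer s (E - A)"
    by (rule subadditiveD) auto
  then show ?thesis by (simp add: Int_Diff_Un)
qed

lemma sets_hausdorff_measureI:
  assumes "\<And>E. hausdorff_outer s (E \<inter> A) + hausdorff_outer s (E - A) \<le> hausdorff_outer s E"
  shows "A \<in> sets (hausdorff_measure s)"
  unfolding sets_hausdorff_measure_iff
  by (intro allI antisym assms hausdorff_outer_le_split)

lemma tendsto_ennreal_inverse_Suc_powr:
  assumes "0 < r"
  shows "(\<lambda>n. ennreal ((1 / real (Suc n)) powr r)) \<longlonglongrightarrow> 0"
proof -
  have "(\<lambda>n. 1 / real (Suc n)) \<longlonglongrightarrow> 0"
    using LIMSEQ_inverse_real_of_nat by (simp add: inverse_eq_divide)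
  then have "(\<lambda>n. (1 / real (Suc n)) powr r) \<longlonglongrightarrow> 0 powr r"
    using assms by (intro tendsto_powr' tendsto_const) auto
  then have "(\<lambda>n. ennreal ((1 / real (Suc n)) powr r)) \<longlonglongrightarrow> ennreal (0 powr r)"
    by (rule tendsto_ennrealI)
  then show ?thesis by simp
qed

text \<open>Let \<delta> tend to 0 in \<open>hausdorff_premeasure_split_le\<close>: the error term
  vanishes because \<open>s > 0\<close>.\<close>

lemma atMost_in_sets_hausdorff_measure:
  assumes "0 < s"
  shows "{..a} \<in> sets (hausdorff_measure s)"
proof (rule sets_hausdorff_measureI)
  fix E
  let ?d = "\<lambda>n. 1 / real (Suc n)"
  have "(\<lambda>n. (ennreal (?d n powr s) + ennreal (?d n powr s)) + hausdorff_premeasure s (?d n) E)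
      \<longlonglongrightarrow> (0 + 0) + hausdorff_outer s E"
    by (intro tendsto_add tendsto_hausdorff_outer tendsto_ennreal_inverse_Suc_powr assms)
  moreover have "(\<lambda>n. hausdorff_premeasure s (?d n) (E \<inter> {..a})
        + hausdorff_premeasure s (?d n) (E - {..a}))
      \<longlonglongrightarrow> hausdorff_outer s (E \<inter> {..a}) + hausdorff_outer s (E - {..a})"
    by (intro tendsto_add tendsto_hausdorff_outer)
  ultimately show "hausdorff_outer s (E \<inter> {..a}) + hausdorff_outer s (E - {..a})
      \<le> hausdorff_outer s E"
    using hausdorff_premeasure_split_le[OF assms, of "?d _" E a]
    by (intro LIMSEQ_le[of _ _ _ "hausdorff_outer s E"]) (auto simp: mult_2)
qed

text \<open>Half-lines generate the Borel sets; this makes the integrand of \<open>Avg\<close>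
  measurable.\<close>

lemma borel_measurable_hausdorff_ident:
  "0 < s \<Longrightarrow> (\<lambda>x. x) \<in> borel_measurable (hausdorff_measure s)"
  using atMost_in_sets_hausdorff_measure
  by (simp add: borel_measurable_iff_le atMost_def)

section \<open>Null sets and comparison of dimensions\<close>

text \<open>Caratheodory's construction is complete: the part of \<open>E\<close> inside
  \<open>A\<close> has outer measure 0, and the rest is at most that of \<open>E\<close>.\<close>

lemma null_sets_hausdorff_measureI:
  assumes "hausdorff_outer s A = 0"
  shows "A \<in> null_sets (hausdorff_measure s)"
proof -
  have "A \<in> sets (hausdorff_measure s)"
  proof (rule sets_hausdorff_measureI)
    fix E
    have "hausdorff_outer s (E \<inter> A) \<le> 0"
      using hausdorff_outer_mono[of "E \<inter> A" A s] assms by simp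
    then show "hausdorff_outer s (E \<inter> A) + hausdorff_outer s (E - A) \<le> hausdorff_outer s E"
      by (simp add: hausdorff_outer_mono)
  qed
  then show ?thesis using assms by (simp add: null_sets_def emeasure_hausdorff_measure)
qed

lemma countable_null_sets_hausdorff_measure:
  assumes "countable C" "0 < s"
  shows "C \<in> null_sets (hausdorff_measure s)"
proof (rule null_sets_hausdorff_measureI)
  have "hausdorff_premeasure s \<delta> C \<le> 0" if "0 < \<delta>" for \<delta>
  proof -
    \<comment> \<open>For finite \<open>C\<close> the enumeration repeats points, and for empty
      \<open>C\<close> it yields an arbitrary one; surplus singletons also have gauge 0.\<close>
    have "C \<subseteq> (\<Union>i. {from_nat_into C i})"
      using from_nat_into_surj[OF assms(1)] by fastforce
    then have "(\<lambda>i. {from_nat_into C i}) \<in> hausdorff_covers \<delta> C"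
      using that by (simp add: hausdorff_covers_def)
    then have "hausdorff_premeasure s \<delta> C \<le> (\<Sum>i. hausdorff_gauge s {from_nat_into C i})"
      unfolding hausdorff_premeasure_def by (rule INF_lower)
    then show ?thesis using assms(2) by (simp add: hausdorff_gauge_def)
  qed
  then have "hausdorff_outer s C \<le> 0"
    unfolding hausdorff_outer_def by (intro SUP_least) auto
  then show "hausdorff_outer s C = 0" by simp
qed

text \<open>A set of diameter d \<le> \<delta> satisfies d^t \<le> \<delta>^(t-s) d^s. Summing over
  a cover bounds the \<open>t\<close>-premeasure by \<delta>^(t-s) times the
  \<open>s\<close>-measure, which tends to 0 with \<delta>.\<close>

lemma hausdorff_outer_eq_0_of_less:
  assumes "0 \<le> s" "s < t" "hausdorff_outer s A < \<infinity>"
  shows "hausdorff_outer t A = 0"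
proof -
  have premeasure: "hausdorff_premeasure t \<delta> A \<le> ennreal (\<delta> powr (t - s)) * hausdorff_outer s A"
    if "0 < \<delta>" for \<delta>
  proof -
    let ?c = "ennreal (\<delta> powr (t - s))"
    have gauge: "hausdorff_gauge t V \<le> ?c * hausdorff_gauge s V"
      if V: "bounded V" "diameter V \<le> \<delta>" for V
    \<comment> \<open>Diameter 0 is split off because for \<open>s = 0\<close> a point has gauge 1
      while \<open>0 powr 0 = 0\<close>; there the \<open>t\<close>-gauge vanishes, as
      \<open>t > 0\<close>.\<close>
    proof (cases "V = {} \<or> diameter V = 0")
      case True
      then show ?thesis using assms by (auto simp: hausdorff_gauge_def)
    next
      case False
      then have pos: "0 < diameter V" using diameter_ge_0[OF V(1)] by simp
      have "diameter V powr t = diameter V powr (t - s) * diameter V powr s"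
        by (simp flip: powr_add)
      also have "\<dots> \<le> \<delta> powr (t - s) * diameter V powr s"
        using assms pos V by (intro mult_right_mono powr_mono2) auto
      finally have "ennreal (diameter V powr t) \<le> ?c * ennreal (diameter V powr s)"
        by (simp add: ennreal_leI flip: ennreal_mult)
      then show ?thesis using False assms pos by (auto simp: hausdorff_gauge_def)
    qed
    have "hausdorff_premeasure t \<delta> A \<le> ?c * (\<Sum>i. hausdorff_gauge s (U i))"
      if U: "U \<in> hausdorff_covers \<delta> A" for U
    proof -
      have "hausdorff_premeasure t \<delta> A \<le> (\<Sum>i. hausdorff_gauge t (U i))"
        unfolding hausdorff_premeasure_def using U by (rule INF_lower)
      also have "\<dots> \<le> (\<Sum>i. ?c * hausdorff_gauge s (U i))"
        using U by (intro suminf_le summableI gauge) (auto simp: hausdorff_covers_def)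
      finally show ?thesis by simp
    qed
    \<comment> \<open>Dividing by the positive finite constant isolates the infimum over covers; the
      division is undone just below.\<close>
    then have "hausdorff_premeasure t \<delta> A / ?c \<le> hausdorff_premeasure s \<delta> A"
      unfolding hausdorff_premeasure_def[of s \<delta> A] using \<open>0 < \<delta>\<close>
      by (intro INF_greatest)
         (simp add: divide_le_posI_ennreal mult.commute)
    also have "\<dots> \<le> hausdorff_outer s A"
      using \<open>0 < \<delta>\<close> by (rule hausdorff_premeasure_le_outer)
    finally have "?c * (hausdorff_premeasure t \<delta> A / ?c) \<le> ?c * hausdorff_outer s A"
      by (rule mult_left_mono) simp
    then show ?thesis
      using \<open>0 < \<delta>\<close> by (simp add: ennreal_times_divide ennreal_mult_divide_eq mult.commute)
  qed
  let ?d = "\<lambda>n. 1 / real (Suc n)"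
  \<comment> \<open>Finiteness of the \<open>s\<close>-measure enters here: multiplication in
    \<open>ennreal\<close> is not continuous at zero times infinity.\<close>
  have "(\<lambda>n. ennreal (?d n powr (t - s)) * hausdorff_outer s A)
      \<longlonglongrightarrow> 0 * hausdorff_outer s A"
    using assms by (intro tendsto_mult_ennreal tendsto_ennreal_inverse_Suc_powr tendsto_const) auto
  then have "hausdorff_outer t A \<le> 0 * hausdorff_outer s A"
    using premeasure by (intro LIMSEQ_le[OF tendsto_hausdorff_outer]) auto
  then show ?thesis by simp
qed

lemma s_set_null_sets_of_less:
  assumes "s_set s H" "s < t"
  shows "H \<in> null_sets (hausdorff_measure t)"
  using assms
  by (intro null_sets_hausdorff_measureI hausdorff_outer_eq_0_of_less[of s])
     (auto simp: s_set_def emeasure_hausdorff_measure)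

text \<open>With two different exponents the set would be null for the larger one, against
  positivity. This justifies the \<open>THE\<close> in \<open>Avg\<close>.\<close>

lemma s_set_unique:
  assumes "s_set s H" "s_set t H"
  shows "s = t"
  using assms s_set_null_sets_of_less[of s H t] s_set_null_sets_of_less[of t H s]
  by (cases s t rule: linorder_cases) (auto simp: s_set_def null_sets_def)

section \<open>The average and its bounds by accumulation points\<close>

lemma Avg_s_set:
  assumes "s_set s H"
  shows "Avg H = (LINT x:H|hausdorff_measure s. x) / measure (hausdorff_measure s) H"
proof -
  have "(THE s. s_set s H) = s"
    using assms s_set_unique by blast
  then show ?thesis by (simp add: Avg_def Let_def)
qed

lemma s_set_measure_pos:
  assumes "s_set s H"
  shows "0 < measure (hausdorff_measure s) H"
  using assms by (simp add: s_set_def measure_def enn2real_positive_iff)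

lemma set_integrable_ident_s_set:
  assumes "s_set s H" "0 < s" "bounded H"
  shows "set_integrable (hausdorff_measure s) H (\<lambda>x. x)"
proof -
  obtain B where "\<And>x. x \<in> H \<Longrightarrow> norm x \<le> B"
    using assms(3) by (auto simp: bounded_iff)
  then show ?thesis
    using assms unfolding set_integrable_def
    by (intro integrableI_bounded_set_indicator[where B = B])
       (auto simp: s_set_def borel_measurable_hausdorff_ident)
qed

text \<open>An isolated point is the only point of \<open>H\<close> in some basic open set
  \<open>B\<close>, so it is recovered from \<open>B\<close> as
  \<open>the_elem (B \<inter> H)\<close>; a countable basis yields only countably many such
  points.\<close>

lemma countable_not_islimpt:
  fixes H :: "'a::second_countable_topology set"
  shows "countable {x \<in> H. \<not> x islimpt H}"
proof -
  obtain \<B> :: "'a set set" where \<B>: "countable \<B>" "topological_basis \<B>"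
    using ex_countable_basis by auto
  have "{x \<in> H. \<not> x islimpt H} \<subseteq> (\<lambda>B. the_elem (B \<inter> H)) ` \<B>"
  proof
    fix x assume x: "x \<in> {x \<in> H. \<not> x islimpt H}"
    then obtain T where T: "x \<in> T" "open T" "T \<inter> H = {x}"
      unfolding islimpt_def by blast
    obtain B where B: "B \<in> \<B>" "x \<in> B" "B \<subseteq> T"
      using topological_basisE[OF \<B>(2) T(2,1)] .
    with T x have "B \<inter> H = {x}" by blast
    with B(1) show "x \<in> (\<lambda>B. the_elem (B \<inter> H)) ` \<B>"
      by (intro image_eqI[of _ _ B]) auto
  qed
  then show ?thesis using \<B>(1) by (meson countable_image countable_subset)
qed

text \<open>Exceptional points are isolated in \<open>H\<close>, hence form a null set. If
  \<open>H\<close> has no accumulation point, the two limits are default values, but then all of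
  \<open>H\<close> is isolated and null.\<close>

lemma AE_hausdorff_between_lims:
  assumes "0 < s" "bounded H"
  shows "AE x in hausdorff_measure s. x \<in> H \<longrightarrow> lower_lim H \<le> x \<and> x \<le> upper_lim H"
proof -
  have "{x. x islimpt H} \<subseteq> closure H" by (auto simp: closure_def)
  then have "bounded {x. x islimpt H}"
    using assms(2) bounded_closure bounded_subset by blast
  then have bdd: "bdd_below {x. x islimpt H}" "bdd_above {x. x islimpt H}"
    by (rule bounded_imp_bdd_below, rule bounded_imp_bdd_above)
  show ?thesis
  proof (rule AE_I')
    show "{x \<in> H. \<not> x islimpt H} \<in> null_sets (hausdorff_measure s)"
      using countable_not_islimpt assms(1) by (rule countable_null_sets_hausdorff_measure)
    show "{x \<in> space (hausdorff_measure s).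
        \<not> (x \<in> H \<longrightarrow> lower_lim H \<le> x \<and> x \<le> upper_lim H)} \<subseteq> {x \<in> H. \<not> x islimpt H}"
      unfolding lower_lim_def upper_lim_def
      using cInf_lower[OF _ bdd(1)] cSup_upper[OF _ bdd(2)] by auto
  qed
qed

text \<open>Integrate the almost everywhere bounds over \<open>H\<close> and divide by its positive,
  finite measure.\<close>

lemma Avg_between_lims:
  assumes "s_set s H" "0 < s" "bounded H"
  shows "lower_lim H \<le> Avg H" "Avg H \<le> upper_lim H"
proof -
  let ?M = "hausdorff_measure s"
  have H: "H \<in> sets ?M" "emeasure ?M H \<noteq> \<infinity>"
    using assms(1) by (auto simp: s_set_def)
  have const: "set_integrable ?M H (\<lambda>_. c :: real)" for c
    using H by (simp add: set_integrable_def less_top)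
  note int = set_integrable_ident_s_set[OF assms]
  note ae = AE_hausdorff_between_lims[OF assms(2,3)]
  have "(LINT x:H|?M. lower_lim H) \<le> (LINT x:H|?M. x)"
    by (rule set_integral_mono_AE[OF const int]) (use ae in auto)
  then show "lower_lim H \<le> Avg H"
    using s_set_measure_pos[OF assms(1)]
    by (simp add: Avg_s_set[OF assms(1)] set_integral_const[OF H] field_simps)
  have "(LINT x:H|?M. x) \<le> (LINT x:H|?M. upper_lim H)"
    by (rule set_integral_mono_AE[OF int const]) (use ae in auto)
  then show "Avg H \<le> upper_lim H"
    using s_set_measure_pos[OF assms(1)]
    by (simp add: Avg_s_set[OF assms(1)] set_integral_const[OF H] field_simps)
qed

section \<open>Averages of unions\<close>

lemma s_set_Un:
  assumes "s_set s A" "s_set s B"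
  shows "s_set s (A \<union> B)"
proof -
  have sets: "A \<in> sets (hausdorff_measure s)" "B \<in> sets (hausdorff_measure s)"
    using assms by (auto simp: s_set_def)
  have "emeasure (hausdorff_measure s) (A \<union> B)
      \<le> emeasure (hausdorff_measure s) A + emeasure (hausdorff_measure s) B"
    using sets by (rule emeasure_subadditive)
  also have "\<dots> < \<infinity>" using assms by (simp add: s_set_def)
  finally have "emeasure (hausdorff_measure s) (A \<union> B) < \<infinity>" .
  moreover have "0 < emeasure (hausdorff_measure s) (A \<union> B)"
    using assms(1) sets emeasure_mono[of A "A \<union> B" "hausdorff_measure s"]
    by (auto simp: s_set_def intro: less_le_trans)
  ultimately show ?thesis using assms(1) sets by (simp add: s_set_def)
qed

lemma s_set_Un_null:
  assumes "s_set s H" "N \<in> null_sets (hausdorff_measure s)"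
  shows "s_set s (H \<union> N)"
  using assms by (auto simp: s_set_def emeasure_Un_null_set)

text \<open>The enlarged set is still an \<open>s\<close>-set, so \<open>Avg\<close> evaluates it
  with the same measure, for which \<open>N\<close> affects neither integral nor mass.\<close>

lemma Avg_Un_null:
  assumes "s_set s H" "N \<in> null_sets (hausdorff_measure s)" "0 < s"
  shows "Avg (H \<union> N) = Avg H"
proof -
  let ?M = "hausdorff_measure s"
  have H: "H \<in> sets ?M" using assms(1) by (simp add: s_set_def)
  have "AE x in ?M. x \<notin> N" using assms(2) by (rule AE_not_in)
  then have "(LINT x:H \<union> N|?M. x) = (LINT x:H|?M. x)"
    using H assms borel_measurable_hausdorff_ident[OF assms(3)]
    by (intro set_integral_cong_set) (auto simp: set_borel_measurable_def)
  moreover have "measure ?M (H \<union> N) = measure ?M H"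
    using H assms(2) by (simp add: measure_def emeasure_Un_null_set)
  ultimately show ?thesis
    by (simp add: Avg_s_set[OF assms(1)] Avg_s_set[OF s_set_Un_null[OF assms(1,2)]])
qed

text \<open>The middle fraction is the mean of the outer two with weights \<open>m\<close> and
  \<open>n\<close>.\<close>

lemma mediant_between:
  fixes a b m n :: real
  assumes "0 < m" "0 < n" "a / m \<le> b / n"
  shows "a / m \<le> (a + b) / (m + n)" "(a + b) / (m + n) \<le> b / n"
  using assms by (simp_all add: field_simps)

lemma Avg_Un_between:
  assumes A: "s_set s A" "bounded A" and B: "s_set s B" "bounded B" and s: "0 < s"
    and le: "upper_lim A \<le> lower_lim B"
  shows "Avg A \<le> Avg (A \<union> B)" "Avg (A \<union> B) \<le> Avg B"
proof -
  let ?M = "hausdorff_measure s"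
  have sets: "A \<in> sets ?M" "B \<in> sets ?M"
    and fin: "emeasure ?M A \<noteq> \<infinity>" "emeasure ?M B \<noteq> \<infinity>"
    using A(1) B(1) by (auto simp: s_set_def)
  \<comment> \<open>Almost every common point of \<open>A\<close> and \<open>B\<close> is at most
    \<open>upper_lim A\<close> and at least \<open>lower_lim B\<close>, so it can only be
    \<open>upper_lim A\<close>; this single point is null too.\<close>
  have "AE x in ?M. x \<notin> {upper_lim A}"
    using s by (intro AE_not_in countable_null_sets_hausdorff_measure) auto
  with AE_hausdorff_between_lims[OF s A(2)] AE_hausdorff_between_lims[OF s B(2)]
  have disj: "AE x in ?M. \<not> (x \<in> A \<and> x \<in> B)"
    by eventually_elim (use le in auto)
  have "(LINT x:A \<union> B|?M. x) = (LINT x:A|?M. x) + (LINT x:B|?M. x)"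
    using disj sets set_integrable_ident_s_set[OF A(1) s A(2)]
      set_integrable_ident_s_set[OF B(1) s B(2)]
    by (rule set_integral_Un_AE)
  moreover have "measure ?M (A \<union> B) = measure ?M A + measure ?M B"
    using disj sets fin by (intro measure_Un_AE) (auto simp: fmeasurable_def less_top)
  ultimately have Avg_Un: "Avg (A \<union> B)
      = ((LINT x:A|?M. x) + (LINT x:B|?M. x)) / (measure ?M A + measure ?M B)"
    by (simp add: Avg_s_set[OF s_set_Un[OF A(1) B(1)]])
  have "Avg A \<le> Avg B"
    using Avg_between_lims(2)[OF A(1) s A(2)] le Avg_between_lims(1)[OF B(1) s B(2)] by linarith
  then show "Avg A \<le> Avg (A \<union> B)" "Avg (A \<union> B) \<le> Avg B"
    unfolding Avg_Un Avg_s_set[OF A(1)] Avg_s_set[OF B(1)]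
    by (rule mediant_between[OF s_set_measure_pos[OF A(1)] s_set_measure_pos[OF B(1)]])+
qed

theorem theorem4p5:
  shows "strong_monotone_on {H. bounded H \<and> (\<exists>s. 0 < s \<and> s \<le> 1 \<and> s_set s H)} Avg"
  unfolding strong_monotone_on_def
proof (intro conjI ballI impI)
  let ?D = "{H. bounded H \<and> (\<exists>s. 0 < s \<and> s \<le> 1 \<and> s_set s H)}"
  show "strong_internal_on ?D Avg"
    unfolding strong_internal_on_def using Avg_between_lims by blast
  fix A B assume "A \<in> ?D" "B \<in> ?D" and le: "upper_lim A \<le> lower_lim B"
  then obtain s t where bdd: "bounded A" "bounded B"
    and s: "0 < s" "s \<le> 1" "s_set s A" and t: "0 < t" "t \<le> 1" "s_set t B"
    by auto
  \<comment> \<open>In unequal dimensions the union has the average of one of the two sets, so this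
    comparison supplies the remaining inequality.\<close>
  have AB: "Avg A \<le> Avg B"
    using Avg_between_lims(2)[OF s(3,1) bdd(1)] le Avg_between_lims(1)[OF t(3,1) bdd(2)]
    by linarith
  have "A \<union> B \<in> ?D \<and> Avg A \<le> Avg (A \<union> B) \<and> Avg (A \<union> B) \<le> Avg B"
  proof (cases s t rule: linorder_cases)
    case less
    have null: "A \<in> null_sets (hausdorff_measure t)"
      using s_set_null_sets_of_less[OF s(3) less] .
    have "s_set t (A \<union> B)" "Avg (A \<union> B) = Avg B"
      using s_set_Un_null[OF t(3) null] Avg_Un_null[OF t(3) null t(1)]
      by (simp_all add: Un_commute)
    then show ?thesis using bdd t AB by auto
  next
    case equal
    then show ?thesis
      using s_set_Un[of s A B] Avg_Un_between[OF s(3) bdd(1) _ bdd(2) s(1) le] bdd s t by auto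
  next
    case greater
    have null: "B \<in> null_sets (hausdorff_measure s)"
      using s_set_null_sets_of_less[OF t(3) greater] .
    have "s_set s (A \<union> B)" "Avg (A \<union> B) = Avg A"
      using s_set_Un_null[OF s(3) null] Avg_Un_null[OF s(3) null s(1)] .
    then show ?thesis using bdd s AB by auto
  qed
  then show "A \<union> B \<in> ?D" "Avg A \<le> Avg (A \<union> B)" "Avg (A \<union> B) \<le> Avg B"
    by blast+
qed

end
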